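(* Let $n_i,n\in\mathbb{N}$, $i=1,\ldots,m$, be such that $\sum_{i=1}^m n_i=n$. Let $f(x)=\sum_{i=1}^m f_i(x_i)$, where $f_i$, $1\le i\le m$, are proper closed functions on $\mathbb{R}^{n_i}$ and $x=(x_1,\ldots,x_m)\in\mathbb{R}^n$ with $x_i\in\mathbb{R}^{n_i}$. Suppose further that each $f_i$ is a KL function with an exponent of $\alpha_i\in(0,1)$ and that each $f_i$ is continuous on $\mathrm{dom}\,\partial f_i$, $i=1,\ldots,m$. Then $f$ is a KL function with an exponent of $\alpha=\max\{\alpha_i:1\le i\le m\}$.
   Context: Closed means lower semicontinuous; proper means never $-\infty$ and not identically $+\infty$; $\mathrm{dom}\,f=\{x: f(x)<\infty\}$. For a proper function $f$ and $x\in\mathrm{dom}\,f$, the regular subdifferential is $\widehat\partial f(x)=\{v: \liminf_{z\to x,z\ne x}\frac{f(z)-f(x)-\langle v,z-x\rangle}{\|z-x\|}\ge 0\}$ and the (limiting) subdifferential $\partial f(x)$ is the set of $v$ for which there exist $x^t\to x$ with $f(x^t)\to f(x)$ and $v^t\to v$ with $v^t\in\widehat\partial f(x^t)$ for each $t$; $\partial f(x)=\emptyset$ if $x\notin\mathrm{dom}\,f$. $\mathrm{dom}\,\partial f=\{x:\partial f(x)\ne\emptyset\}$. "$f$ is continuous on a set $S$" means that the restriction of $f$ to $S$ is continuous. A proper closed function $f$ has the KL property at $\bar x\in\mathrm{dom}\,\partial f$ with an exponent of $\alpha\in[0,1)$ if there exist $c,\epsilon>0$ and $\nu\in(0,\infty]$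 such that $\mathrm{dist}(0,\partial f(x))\ge c\,(f(x)-f(\bar x))^\alpha$ whenever $\|x-\bar x\|\le\epsilon$ and $f(\bar x)<f(x)<f(\bar x)+\nu$ (with $\mathrm{dist}(0,\emptyset)=+\infty$). It is a KL function with an exponent of $\alpha$ if it has the KL property with exponent $\alpha$ at every $\bar x\in\mathrm{dom}\,\partial f$. *)

theory Defs
  imports "HOL-Analysis.Analysis"
begin

text \<open>
  Since several dimensions occur in one statement, \<open>\<real>\<^sup>n\<close> is rendered as the library's
  \<^const>\<open>Euclidean_space\<close> \<open>n\<close>: its points are the sequences \<open>x 0, \<dots>, x (n - 1), 0, 0, \<dots>\<close>,
  with the coordinatewise topology. Extended-real-valued functions on \<open>\<real>\<^sup>n\<close> have type
  \<open>(nat \<Rightarrow> real) \<Rightarrow> ereal\<close>; their values outside \<open>\<real>\<^sup>n\<close> are never inspected.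
\<close>

abbreviation Rn :: "nat \<Rightarrow> (nat \<Rightarrow> real) set" where
  "Rn n \<equiv> topspace (Euclidean_space n)"

definition Rn_inner :: "nat \<Rightarrow> (nat \<Rightarrow> real) \<Rightarrow> (nat \<Rightarrow> real) \<Rightarrow> real" where
  "Rn_inner n x y = (\<Sum>i<n. x i * y i)"

definition Rn_norm :: "nat \<Rightarrow> (nat \<Rightarrow> real) \<Rightarrow> real" where
  "Rn_norm n x = L2_set x {..<n}"

definition Rn_diff :: "(nat \<Rightarrow> real) \<Rightarrow> (nat \<Rightarrow> real) \<Rightarrow> nat \<Rightarrow> real" where
  "Rn_diff x y = (\<lambda>i. x i - y i)"

definition edom :: "nat \<Rightarrow> ((nat \<Rightarrow> real) \<Rightarrow> ereal) \<Rightarrow> (nat \<Rightarrow> real) set" where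
  "edom n f = {x \<in> Rn n. f x < \<infinity>}"

definition proper_fun :: "nat \<Rightarrow> ((nat \<Rightarrow> real) \<Rightarrow> ereal) \<Rightarrow> bool" where
  "proper_fun n f \<longleftrightarrow> (\<forall>x\<in>Rn n. f x \<noteq> -\<infinity>) \<and> (\<exists>x\<in>Rn n. f x \<noteq> \<infinity>)"

definition closed_fun :: "nat \<Rightarrow> ((nat \<Rightarrow> real) \<Rightarrow> ereal) \<Rightarrow> bool" where
  "closed_fun n f \<longleftrightarrow> (\<forall>x\<in>Rn n. f x \<le> Liminf (nhdsin (Euclidean_space n) x) f)"

text \<open>
  \<open>atin\<close> is the punctured neighbourhood filter within \<open>\<real>\<^sup>n\<close>. The denominator is positive along
  it, and \<open>f x\<close> is finite when \<open>f\<close> is proper, so the \<^typ>\<open>ereal\<close> quotient is the usual one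
  (it is \<open>\<infinity>\<close> where \<open>f z = \<infinity>\<close>).
\<close>

definition regular_subdiff ::
    "nat \<Rightarrow> ((nat \<Rightarrow> real) \<Rightarrow> ereal) \<Rightarrow> (nat \<Rightarrow> real) \<Rightarrow> (nat \<Rightarrow> real) set" where
  "regular_subdiff n f x =
     (if x \<in> edom n f
      then {v \<in> Rn n.
              Liminf (atin (Euclidean_space n) x)
                (\<lambda>z. (f z - f x - ereal (Rn_inner n v (Rn_diff z x)))
                       / ereal (Rn_norm n (Rn_diff z x))) \<ge> 0}
      else {})"

definition limiting_subdiff ::
    "nat \<Rightarrow> ((nat \<Rightarrow> real) \<Rightarrow> ereal) \<Rightarrow> (nat \<Rightarrow> real) \<Rightarrow> (nat \<Rightarrow> real) set" where
  "limiting_subdiff n f x =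
     (if x \<in> edom n f
      then {v. \<exists>xs vs. limitin (Euclidean_space n) xs x sequentially
                 \<and> (\<lambda>t. f (xs t)) \<longlonglongrightarrow> f x
                 \<and> limitin (Euclidean_space n) vs v sequentially
                 \<and> (\<forall>t. vs t \<in> regular_subdiff n f (xs t))}
      else {})"

definition dom_subdiff :: "nat \<Rightarrow> ((nat \<Rightarrow> real) \<Rightarrow> ereal) \<Rightarrow> (nat \<Rightarrow> real) set" where
  "dom_subdiff n f = {x \<in> Rn n. limiting_subdiff n f x \<noteq> {}}"

text \<open>The infimum over the empty set is \<open>\<infinity>\<close> in \<^typ>\<open>ereal\<close>.\<close>

definition dist_zero :: "nat \<Rightarrow> (nat \<Rightarrow> real) set \<Rightarrow> ereal" where
  "dist_zero n A = (INF v\<in>A. ereal (Rn_norm n v))"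

text \<open>
  Where the inequality is required, \<open>f x - f xb\<close> is finite and positive, so neither
  \<^const>\<open>real_of_ereal\<close> nor \<open>powr\<close> is used at a junk value.
\<close>

definition KL_property_at ::
    "nat \<Rightarrow> ((nat \<Rightarrow> real) \<Rightarrow> ereal) \<Rightarrow> (nat \<Rightarrow> real) \<Rightarrow> real \<Rightarrow> bool" where
  "KL_property_at n f xb \<alpha> \<longleftrightarrow>
     proper_fun n f \<and> closed_fun n f \<and> xb \<in> dom_subdiff n f \<and> 0 \<le> \<alpha> \<and> \<alpha> < 1 \<and>
     (\<exists>(c::real) (\<epsilon>::real) (\<nu>::ereal). 0 < c \<and> 0 < \<epsilon> \<and> 0 < \<nu> \<and>
        (\<forall>x\<in>Rn n. Rn_norm n (Rn_diff x xb) \<le> \<epsilon> \<and> f xb < f x \<and> f x < f xb + \<nu> \<longrightarrow>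
           ereal (c * real_of_ereal (f x - f xb) powr \<alpha>)
             \<le> dist_zero n (limiting_subdiff n f x)))"

definition KL_function :: "nat \<Rightarrow> ((nat \<Rightarrow> real) \<Rightarrow> ereal) \<Rightarrow> real \<Rightarrow> bool" where
  "KL_function n f \<alpha> \<longleftrightarrow>
     proper_fun n f \<and> closed_fun n f \<and> 0 \<le> \<alpha> \<and> \<alpha> < 1 \<and>
     (\<forall>xb\<in>dom_subdiff n f. KL_property_at n f xb \<alpha>)"

text \<open>
  The \<open>i\<close>-th block \<open>x\<^sub>i \<in> \<real>\<^bsup>ns i\<^esup>\<close> of \<open>x = (x\<^sub>1, \<dots>, x\<^sub>m)\<close>, blocks being numbered from 1 and
  coordinates from 0.
\<close>

definition block :: "(nat \<Rightarrow> nat) \<Rightarrow> nat \<Rightarrow> (nat \<Rightarrow> real) \<Rightarrow> (nat \<Rightarrow> real)" where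
  "block ns i x = (\<lambda>k. if k < ns i then x ((\<Sum>j\<in>{1..<i}. ns j) + k) else 0)"

end

theory Submission
  imports Defs
begin

text \<open>
  Only the easy half of the product rule for limiting subgradients is used: every block of a
  limiting subgradient of \<open>f\<close> is a limiting subgradient of the corresponding summand
  (\<open>limiting_subdiff_block\<close>). For regular subgradients, move only one block of \<open>x\<close>: the
  difference quotient of \<open>f\<close> becomes that of \<open>F i\<close>, and a lower limit does not decrease when it is
  taken along a restricted approach. To pass to limits one needs \<open>F i (x\<^sub>i\<^sup>t) \<rightarrow> F i (x\<^sub>i)\<close> for
  each \<open>i\<close>, whereas only the values of the sum are known to converge; since every summand is lower
  semicontinuous, no summand can stay above its limit without another one falling below
  (\<open>tendsto_summand\<close>).

  Let now \<open>v\<close> be a limiting subgradient of \<open>f\<close> at a point \<open>x\<close> near \<open>xb\<close> with \<open>f xb < f x\<close>. Some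
  block \<open>i\<close> carries at least the share \<open>(f x - f xb) / m\<close> of the increment
  (\<open>ex_large_block_increment\<close>). The block of \<open>x\<close> lies in the domain of the subdifferential of
  \<open>F i\<close>, where \<open>F i\<close> is continuous; hence \<open>F i\<close> exceeds its value at the block of \<open>xb\<close> by less
  than both \<open>1\<close> and the bound under which its KL inequality holds. That inequality then applies,
  and the exponent may be enlarged to the maximum \<open>\<alpha>\<close> because the increment is below \<open>1\<close>
  (\<open>KL_property_at_nhdsin\<close>). As \<open>\<parallel>v\<parallel> \<ge> \<parallel>v\<^sub>i\<parallel>\<close>, this bounds \<open>\<parallel>v\<parallel>\<close> below by a multiple of
  \<open>(f x - f xb)\<^sup>\<alpha>\<close>. Near \<open>xb\<close> continuity alone already bounds these increments, which is why
  \<open>\<nu> = \<infinity>\<close> serves for \<open>f\<close>.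
\<close>

section \<open>Lower limits\<close>

lemma filterlim_nhdsin_of_limitin:
  assumes "limitin X h x G"
  shows "filterlim h (nhdsin X x) G"
  using assms unfolding filterlim_iff eventually_nhdsin limitin_def
  by (metis (mono_tags, lifting) eventually_mono)

lemma filterlim_nhdsin_continuous_map:
  assumes "continuous_map X Y h" "x \<in> topspace X"
  shows "filterlim h (nhdsin Y (h x)) (nhdsin X x)"
  unfolding filterlim_iff
proof (intro allI impI)
  fix P assume "eventually P (nhdsin Y (h x))"
  moreover have "h x \<in> topspace Y"
    using assms by (auto simp: continuous_map_def)
  ultimately obtain S where S: "openin Y S" "h x \<in> S" "\<forall>y\<in>S. P y"
    by (auto simp: eventually_nhdsin)
  have "openin X {z \<in> topspace X. h z \<in> S}"
    using assms(1) S(1) by (rule openin_continuous_map_preimage)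
  then show "\<forall>\<^sub>F z in nhdsin X x. P (h z)"
    unfolding eventually_nhdsin using S assms(2) by blast
qed

lemma le_Liminf_compose:
  fixes g :: "'a \<Rightarrow> ereal"
  assumes "filterlim h F G" "c \<le> Liminf F g"
  shows "c \<le> Liminf G (\<lambda>z. g (h z))"
  using assms unfolding le_Liminf_iff filterlim_iff by auto

text \<open>
  Below \<open>a + b\<close> lie sums \<open>p + q\<close> with \<open>p < a\<close> and \<open>q < b\<close>, and eventually \<open>X\<close> and \<open>Y\<close> exceed
  \<open>p\<close> and \<open>q\<close>. Excluding \<open>-\<infinity>\<close> for \<open>a\<close> and \<open>b\<close> is necessary because \<open>\<infinity> + (-\<infinity>) = \<infinity>\<close> in
  \<^typ>\<open>ereal\<close>.
\<close>

lemma le_Liminf_add: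
  fixes X Y :: "'a \<Rightarrow> ereal"
  assumes "a \<noteq> -\<infinity>" "b \<noteq> -\<infinity>" and X: "a \<le> Liminf G X" and Y: "b \<le> Liminf G Y"
  shows "a + b \<le> Liminf G (\<lambda>z. X z + Y z)"
  unfolding le_Liminf_iff
proof (intro allI impI)
  fix y assume y: "y < a + b"
  have "\<exists>p q. p < a \<and> q < b \<and> y \<le> p + q"
  proof (cases y)
    case (real r)
    show ?thesis
    proof (cases rule: ereal2_cases[of a b])
      case (real_real s t)
      then show ?thesis using real y
        by (intro exI[of _ "ereal (s - (s + t - r) / 2)"] exI[of _ "ereal (t - (s + t - r) / 2)"])
           (auto simp: field_simps)
    next
      case (real_PInf s)
      then show ?thesis using real
        by (intro exI[of _ "ereal (s - 1)"] exI[of _ "ereal (r - s + 1)"]) auto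
    next
      case (PInf_real t)
      then show ?thesis using real
        by (intro exI[of _ "ereal (r - t + 1)"] exI[of _ "ereal (t - 1)"]) auto
    next
      case PInf_PInf
      then show ?thesis using real
        by (intro exI[of _ "ereal r"] exI[of _ "ereal 0"]) auto
    qed (use assms in auto)
  next
    case MInf
    then show ?thesis using assms by (intro exI[of _ "-\<infinity>"]) auto
  qed (use y in auto)
  then obtain p q where pq: "p < a" "q < b" "y \<le> p + q" by blast
  have "\<forall>\<^sub>F z in G. p < X z" "\<forall>\<^sub>F z in G. q < Y z"
    using X Y pq by (auto simp: le_Liminf_iff)
  then show "\<forall>\<^sub>F z in G. y < X z + Y z"
    by eventually_elim (use pq in \<open>auto intro: le_less_trans ereal_add_strict_mono2\<close>)
qed

lemma sum_ereal_not_MInf: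
  fixes l :: "'i \<Rightarrow> ereal"
  assumes "\<And>i. i \<in> I \<Longrightarrow> l i \<noteq> -\<infinity>"
  shows "sum l I \<noteq> -\<infinity>"
  using assms by (induction I rule: infinite_finite_induct) simp_all

lemma le_Liminf_sum:
  fixes X :: "'i \<Rightarrow> 'a \<Rightarrow> ereal"
  assumes "finite I" "\<And>i. i \<in> I \<Longrightarrow> l i \<noteq> -\<infinity>" "\<And>i. i \<in> I \<Longrightarrow> l i \<le> Liminf G (X i)"
  shows "sum l I \<le> Liminf G (\<lambda>z. \<Sum>i\<in>I. X i z)"
  using assms
proof (induction I)
  case empty
  then show ?case by (simp add: le_Liminf_iff)
next
  case (insert i I)
  have "sum l I \<noteq> -\<infinity>"
    using insert.prems by (intro sum_ereal_not_MInf) auto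
  then have "l i + sum l I \<le> Liminf G (\<lambda>z. X i z + (\<Sum>i\<in>I. X i z))"
    using insert by (intro le_Liminf_add) auto
  then show ?case
    using insert.hyps by simp
qed

text \<open>
  The upper estimate for the \<open>i\<close>-th summand comes from the lower estimates for the others:
  \<open>- X i\<close> is the sum of the \<open>X j\<close> with \<open>j \<noteq> i\<close> minus the convergent total sum, so its lower limit
  is at least \<open>- l i\<close>.
\<close>

lemma tendsto_summand:
  fixes X :: "'i \<Rightarrow> 'a \<Rightarrow> ereal"
  assumes I: "finite I" "i \<in> I"
    and fin: "\<And>j. j \<in> I \<Longrightarrow> \<bar>l j\<bar> \<noteq> \<infinity>" "\<And>j t. j \<in> I \<Longrightarrow> \<bar>X j t\<bar> \<noteq> \<infinity>"
    and lsc: "\<And>j. j \<in> I \<Longrightarrow> l j \<le> Liminf G (X j)"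
    and lim: "((\<lambda>t. \<Sum>j\<in>I. X j t) \<longlongrightarrow> sum l I) G"
  shows "(X i \<longlongrightarrow> l i) G"
proof (rule order_tendstoI)
  show "\<forall>\<^sub>F t in G. a < X i t" if "a < l i" for a
    using lsc[OF I(2)] that by (auto simp: le_Liminf_iff)
next
  fix a assume a: "l i < a"
  let ?J = "I - {i}"
  have "- sum l I \<le> Liminf G (\<lambda>t. - (\<Sum>j\<in>I. X j t))"
    using lim_imp_Liminf[OF _ tendsto_uminus_ereal[OF lim]] by (cases "G = bot") simp_all
  moreover have "sum l ?J \<le> Liminf G (\<lambda>t. \<Sum>j\<in>?J. X j t)"
  proof (rule le_Liminf_sum)
    show "l j \<noteq> -\<infinity>" if "j \<in> ?J" for j
      using fin(1)[of j] that by auto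
  qed (use I lsc in auto)
  moreover have finJ: "\<bar>sum l ?J\<bar> \<noteq> \<infinity>" "\<bar>sum l I\<bar> \<noteq> \<infinity>"
    "\<And>t. \<bar>\<Sum>j\<in>?J. X j t\<bar> \<noteq> \<infinity>"
    using fin I by (auto simp: sum_Inf)
  ultimately have "sum l ?J + - sum l I \<le> Liminf G (\<lambda>t. (\<Sum>j\<in>?J. X j t) + - (\<Sum>j\<in>I. X j t))"
    by (intro le_Liminf_add) auto
  moreover have "u + - (v + u) = - v" if "\<bar>u\<bar> \<noteq> \<infinity>" "\<bar>v\<bar> \<noteq> \<infinity>" for u v :: ereal
    using that by (cases rule: ereal2_cases[of u v]) auto
  moreover have "sum l I = l i + sum l ?J" "(\<Sum>j\<in>I. X j t) = X i t + (\<Sum>j\<in>?J. X j t)" for t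
    using I by (simp_all add: sum.remove)
  ultimately have "- l i \<le> Liminf G (\<lambda>t. - X i t)"
    using finJ fin I by simp
  moreover have "- a < - l i"
    using a by simp
  ultimately have "\<forall>\<^sub>F t in G. - a < - X i t"
    by (simp only: le_Liminf_iff)
  then show "\<forall>\<^sub>F t in G. X i t < a" by simp
qed

section \<open>Neighbourhoods in Euclidean space\<close>

lemma Euclidean_space_top_of_set:
  "Euclidean_space n = top_of_set {x. \<forall>i\<ge>n. x i = 0}"
  by (simp add: Euclidean_space_def euclidean_product_topology)

lemma eventually_Rn_norm_le:
  assumes "x \<in> Rn n" "0 < e"
  shows "\<forall>\<^sub>F z in nhdsin (Euclidean_space n) x. z \<in> Rn n \<and> Rn_norm n (Rn_diff z x) \<le> e"
proof -
  have "continuous_map (Euclidean_space n) euclideanreal (\<lambda>z. Rn_norm n (Rn_diff z x))"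
    unfolding Euclidean_space_top_of_set Rn_norm_def L2_set_def Rn_diff_def
    by (auto intro!: continuous_intros continuous_on_product_coordinates
          intro: continuous_on_subset)
  from openin_continuous_map_preimage[OF this, of "{..<e}"]
  have "openin (Euclidean_space n) {z \<in> Rn n. Rn_norm n (Rn_diff z x) < e}"
    by simp
  moreover have "Rn_norm n (Rn_diff x x) = 0"
    by (simp add: Rn_norm_def Rn_diff_def L2_set_def)
  ultimately show ?thesis
    unfolding eventually_nhdsin using assms
    by (intro disjI2 exI[of _ "{z \<in> Rn n. Rn_norm n (Rn_diff z x) < e}"]) auto
qed

text \<open>
  The topology of \<^term>\<open>Euclidean_space n\<close> is coordinatewise. If no ball worked, points outside
  \<open>P\<close> at distance at most \<open>1 / (k + 1)\<close> from \<open>x\<close> would converge to \<open>x\<close> in each coordinate.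
\<close>

lemma Rn_norm_ball_nhdsin:
  assumes x: "x \<in> Rn n" and P: "eventually P (nhdsin (Euclidean_space n) x)"
  obtains e where "0 < e" "\<And>z. z \<in> Rn n \<Longrightarrow> Rn_norm n (Rn_diff z x) \<le> e \<Longrightarrow> P z"
proof (rule ccontr)
  assume neg: "\<not> thesis"
  have "\<exists>z. z \<in> Rn n \<and> Rn_norm n (Rn_diff z x) \<le> inverse (Suc k) \<and> \<not> P z" for k
    using neg that[of "inverse (Suc k)"] by fastforce
  then obtain s where s: "\<And>k. s k \<in> Rn n" "\<And>k. Rn_norm n (Rn_diff (s k) x) \<le> inverse (Suc k)"
      "\<And>k. \<not> P (s k)"
    by metis
  have "(\<lambda>k. s k i) \<longlonglongrightarrow> x i" for i
  proof (cases "i < n")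
    case True
    have "norm (s k i - x i) \<le> inverse (Suc k)" for k
      using member_le_L2_set[of "{..<n}" i "\<lambda>i. \<bar>s k i - x i\<bar>"] s(2)[of k] True
      by (simp add: Rn_norm_def Rn_diff_def L2_set_def)
    then have "(\<lambda>k. s k i - x i) \<longlonglongrightarrow> 0"
      by (intro Lim_null_comparison[OF always_eventually LIMSEQ_inverse_real_of_nat]) blast
    then show ?thesis by (simp add: LIM_zero_iff)
  next
    case False
    then show ?thesis using s(1) x by (simp add: topspace_Euclidean_space)
  qed
  then have "limitin (Euclidean_space n) s x sequentially"
    using s(1) x unfolding Euclidean_space_def
    by (auto simp: limitin_subtopology limitin_componentwise topspace_Euclidean_space[unfolded Euclidean_space_def])
  then have "\<forall>\<^sub>F k in sequentially. P (s k)"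
    using P filterlim_nhdsin_of_limitin unfolding filterlim_iff by metis
  then show False using s(3) by simp
qed

section \<open>Blocks\<close>

abbreviation block_start :: "(nat \<Rightarrow> nat) \<Rightarrow> nat \<Rightarrow> nat" where
  "block_start ns i \<equiv> (\<Sum>j\<in>{1..<i}. ns j)"

definition put_block ::
    "(nat \<Rightarrow> nat) \<Rightarrow> nat \<Rightarrow> (nat \<Rightarrow> real) \<Rightarrow> (nat \<Rightarrow> real) \<Rightarrow> nat \<Rightarrow> real" where
  "put_block ns i x z =
     (\<lambda>k. if block_start ns i \<le> k \<and> k < block_start ns i + ns i
          then z (k - block_start ns i) else x k)"

lemma block_in_Rn [simp]: "block ns i x \<in> Rn (ns i)"
  by (simp add: block_def topspace_Euclidean_space)

lemma block_start_add: "1 \<le> i \<Longrightarrow> block_start ns i + ns i = block_start ns (Suc i)"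
  by simp

lemma block_start_mono: "i \<le> j \<Longrightarrow> block_start ns i \<le> block_start ns j"
  by (rule sum_mono2) auto

lemma block_start_add_le:
  assumes "i \<in> {1..m}"
  shows "block_start ns i + ns i \<le> (\<Sum>i=1..m. ns i)"
proof -
  have "block_start ns i + ns i = (\<Sum>j=1..i. ns j)"
    using assms by (simp add: sum.last_plus)
  also have "\<dots> \<le> (\<Sum>i=1..m. ns i)"
    using assms by (intro sum_mono2) auto
  finally show ?thesis .
qed

lemma put_block_in_Rn:
  assumes "i \<in> {1..m}" "x \<in> Rn (\<Sum>i=1..m. ns i)"
  shows "put_block ns i x z \<in> Rn (\<Sum>i=1..m. ns i)"
  using assms block_start_add_le[OF assms(1), of ns]
  by (auto simp: put_block_def topspace_Euclidean_space)

lemma block_put_block_same: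
  assumes "z \<in> Rn (ns i)"
  shows "block ns i (put_block ns i x z) = z"
  using assms by (auto simp: put_block_def block_def topspace_Euclidean_space fun_eq_iff)

text \<open>The index ranges of two different blocks are disjoint.\<close>

lemma block_put_block_other:
  assumes "1 \<le> i" "1 \<le> j" "i \<noteq> j"
  shows "block ns j (put_block ns i x z) = block ns j x"
proof -
  have "block_start ns i + ns i \<le> block_start ns j \<or> block_start ns j + ns j \<le> block_start ns i"
  proof (cases "i < j")
    case True
    then show ?thesis
      using block_start_mono[of "Suc i" j ns] assms by (simp add: block_start_add)
  next
    case False
    then show ?thesis
      using block_start_mono[of "Suc j" i ns] assms by (simp add: block_start_add)
  qed
  then show ?thesis
    by (auto simp: put_block_def block_def fun_eq_iff)
qed

lemma put_block_block: "put_block ns i x (block ns i x) = x"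
  by (auto simp: put_block_def block_def fun_eq_iff)

text \<open>Prescribed blocks are put in place one after the other, starting from the zero vector.\<close>

lemma ex_blocks:
  assumes "\<And>i. i \<in> {1..m} \<Longrightarrow> y i \<in> Rn (ns i)"
  shows "\<exists>x\<in>Rn (\<Sum>i=1..m. ns i). \<forall>i\<in>{1..m}. block ns i x = y i"
proof -
  let ?n = "\<Sum>i=1..m. ns i"
  have "\<exists>x\<in>Rn ?n. \<forall>i\<in>{1..k}. block ns i x = y i" if "k \<le> m" for k
    using that
  proof (induction k)
    case 0
    have "(\<lambda>_. 0) \<in> Rn ?n" by (simp add: topspace_Euclidean_space)
    then show ?case by auto
  next
    case (Suc k)
    then obtain x where x: "x \<in> Rn ?n" "\<forall>i\<in>{1..k}. block ns i x = y i" by auto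
    let ?x = "put_block ns (Suc k) x (y (Suc k))"
    have "?x \<in> Rn ?n"
      using x Suc.prems by (intro put_block_in_Rn) auto
    moreover have "block ns i ?x = y i" if "i \<in> {1..Suc k}" for i
      using that x Suc.prems assms[of "Suc k"]
      by (cases "i = Suc k") (auto simp: block_put_block_same block_put_block_other)
    ultimately show ?case by blast
  qed
  then show ?thesis by blast
qed

lemma continuous_map_block:
  "continuous_map (Euclidean_space n) (Euclidean_space (ns i)) (block ns i)"
  unfolding block_def continuous_map_componentwise_Euclidean_space
  by (auto simp: Euclidean_space_top_of_set
        intro!: continuous_on_product_coordinates intro: continuous_on_subset)

lemma filterlim_block:
  assumes "x \<in> Rn n"
  shows "filterlim (block ns i) (nhdsin (Euclidean_space (ns i)) (block ns i x))
           (nhdsin (Euclidean_space n) x)"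
  using continuous_map_block assms by (rule filterlim_nhdsin_continuous_map)

lemma limitin_block:
  assumes "limitin (Euclidean_space n) s x G"
  shows "limitin (Euclidean_space (ns i)) (\<lambda>t. block ns i (s t)) (block ns i x) G"
  using continuous_map_limit[OF continuous_map_block assms] by (simp add: o_def)

lemma continuous_map_put_block:
  assumes "i \<in> {1..m}" "x \<in> Rn (\<Sum>i=1..m. ns i)"
  shows "continuous_map (Euclidean_space (ns i)) (Euclidean_space (\<Sum>i=1..m. ns i)) (put_block ns i x)"
proof -
  have "continuous_on {z. \<forall>j\<ge>ns i. z j = 0} (\<lambda>z. put_block ns i x z k)" for k
    by (cases "block_start ns i \<le> k \<and> k < block_start ns i + ns i")
       (auto simp: put_block_def intro!: continuous_on_product_coordinates intro: continuous_on_subset)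
  then have "continuous_on {z. \<forall>j\<ge>ns i. z j = 0} (put_block ns i x)"
    by (rule continuous_on_coordinatewise_then_product)
  then show ?thesis
    using put_block_in_Rn[OF assms] unfolding Euclidean_space_top_of_set
    by (auto simp: continuous_map_in_subtopology topspace_Euclidean_space)
qed

lemma sum_supported_on_block:
  fixes g :: "nat \<Rightarrow> real"
  assumes "i \<in> {1..m}"
    and "\<And>k. \<not> (block_start ns i \<le> k \<and> k < block_start ns i + ns i) \<Longrightarrow> g k = 0"
  shows "(\<Sum>k<(\<Sum>i=1..m. ns i). g k) = (\<Sum>k<ns i. g (block_start ns i + k))"
proof -
  let ?o = "block_start ns i"
  have "(\<Sum>k<(\<Sum>i=1..m. ns i). g k) = sum g {0 + ?o..<ns i + ?o}"
    using assms block_start_add_le[OF assms(1), of ns]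
    by (intro sum.mono_neutral_right) auto
  also have "\<dots> = (\<Sum>k<ns i. g (?o + k))"
    by (subst sum.shift_bounds_nat_ivl) (simp add: atLeast0LessThan add.commute)
  finally show ?thesis .
qed

lemma Rn_inner_put_block:
  assumes "i \<in> {1..m}"
  shows "Rn_inner (\<Sum>i=1..m. ns i) v (Rn_diff (put_block ns i x z) x)
           = Rn_inner (ns i) (block ns i v) (Rn_diff z (block ns i x))"
  unfolding Rn_inner_def
  by (subst sum_supported_on_block[OF assms])
     (auto simp: Rn_diff_def put_block_def block_def)

lemma Rn_norm_put_block:
  assumes "i \<in> {1..m}"
  shows "Rn_norm (\<Sum>i=1..m. ns i) (Rn_diff (put_block ns i x z) x)
           = Rn_norm (ns i) (Rn_diff z (block ns i x))"
  unfolding Rn_norm_def L2_set_def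
  by (subst sum_supported_on_block[OF assms])
     (auto simp: Rn_diff_def put_block_def block_def)

lemma Rn_norm_block_le:
  assumes "i \<in> {1..m}"
  shows "Rn_norm (ns i) (block ns i v) \<le> Rn_norm (\<Sum>i=1..m. ns i) v"
proof -
  let ?o = "block_start ns i"
  have "(\<Sum>k<ns i. (block ns i v k)\<^sup>2) = (\<Sum>k\<in>{0 + ?o..<ns i + ?o}. (v k)\<^sup>2)"
    by (subst sum.shift_bounds_nat_ivl) (simp add: atLeast0LessThan block_def add.commute)
  also have "\<dots> \<le> (\<Sum>k<(\<Sum>i=1..m. ns i). (v k)\<^sup>2)"
    using block_start_add_le[OF assms, of ns] by (intro sum_mono2) auto
  finally show ?thesis by (simp add: Rn_norm_def L2_set_def)
qed

section \<open>Subgradients of a separable sum\<close>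

locale separable_sum =
  fixes m n :: nat and ns :: "nat \<Rightarrow> nat"
    and F :: "nat \<Rightarrow> (nat \<Rightarrow> real) \<Rightarrow> ereal" and f :: "(nat \<Rightarrow> real) \<Rightarrow> ereal"
  assumes dim: "(\<Sum>i=1..m. ns i) = n"
    and f_eq: "\<And>x. x \<in> Rn n \<Longrightarrow> f x = (\<Sum>i=1..m. F i (block ns i x))"
    and proper: "\<And>i. i \<in> {1..m} \<Longrightarrow> proper_fun (ns i) (F i)"
    and closed: "\<And>i. i \<in> {1..m} \<Longrightarrow> closed_fun (ns i) (F i)"
begin

lemma F_not_MInf: "i \<in> {1..m} \<Longrightarrow> z \<in> Rn (ns i) \<Longrightarrow> F i z \<noteq> -\<infinity>"
  using proper by (auto simp: proper_fun_def)

lemma F_finite: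
  assumes "x \<in> edom n f" "i \<in> {1..m}"
  shows "\<bar>F i (block ns i x)\<bar> \<noteq> \<infinity>"
proof -
  have "(\<Sum>i=1..m. F i (block ns i x)) \<noteq> \<infinity>"
    using assms f_eq by (auto simp: edom_def)
  then have "F i (block ns i x) \<noteq> \<infinity>"
    using assms(2) by (auto simp: sum_Pinfty)
  then show ?thesis
    using F_not_MInf[OF assms(2), of "block ns i x"] by auto
qed

lemma F_le_Liminf_compose:
  assumes "i \<in> {1..m}" "z \<in> Rn (ns i)" "filterlim h (nhdsin (Euclidean_space (ns i)) z) G"
  shows "F i z \<le> Liminf G (\<lambda>t. F i (h t))"
  using assms(3)
proof (rule le_Liminf_compose)
  show "F i z \<le> Liminf (nhdsin (Euclidean_space (ns i)) z) (F i)"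
    using closed assms by (auto simp: closed_fun_def)
qed

lemma proper_f: "proper_fun n f"
proof -
  have "f x \<noteq> -\<infinity>" if "x \<in> Rn n" for x
    using that F_not_MInf by (simp only: f_eq) (intro sum_ereal_not_MInf, auto)
  moreover have "\<forall>i\<in>{1..m}. \<exists>y\<in>Rn (ns i). F i y \<noteq> \<infinity>"
    using proper by (auto simp: proper_fun_def)
  then obtain y where "\<And>i. i \<in> {1..m} \<Longrightarrow> y i \<in> Rn (ns i) \<and> F i (y i) \<noteq> \<infinity>"
    by metis
  with ex_blocks[of m y ns] dim
  obtain x where "x \<in> Rn n" "\<forall>i\<in>{1..m}. block ns i x = y i \<and> F i (y i) \<noteq> \<infinity>"
    by blast
  then have "x \<in> Rn n" "f x \<noteq> \<infinity>"
    by (simp_all add: f_eq sum_Pinfty)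
  then have "\<exists>x\<in>Rn n. f x \<noteq> \<infinity>" by blast
  ultimately show ?thesis by (simp add: proper_fun_def)
qed

lemma closed_f: "closed_fun n f"
  unfolding closed_fun_def
proof
  fix x assume x: "x \<in> Rn n"
  have "(\<Sum>i=1..m. F i (block ns i x))
      \<le> Liminf (nhdsin (Euclidean_space n) x) (\<lambda>z. \<Sum>i=1..m. F i (block ns i z))"
    using F_not_MInf
    by (intro le_Liminf_sum F_le_Liminf_compose filterlim_block[OF x]) auto
  also have "\<dots> = Liminf (nhdsin (Euclidean_space n) x) f"
  proof (rule Liminf_eq)
    show "\<forall>\<^sub>F z in nhdsin (Euclidean_space n) x. (\<Sum>i=1..m. F i (block ns i z)) = f z"
      using eventually_Rn_norm_le[OF x zero_less_one] by eventually_elim (simp add: f_eq)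
  qed
  finally show "f x \<le> Liminf (nhdsin (Euclidean_space n) x) f"
    using x by (simp add: f_eq)
qed

text \<open>
  The other summands cancel because they are finite at a point of the domain; \<^term>\<open>F i z\<close> may
  still be \<open>\<infinity>\<close>.
\<close>

lemma f_put_block_diff:
  assumes x: "x \<in> edom n f" and i: "i \<in> {1..m}" and z: "z \<in> Rn (ns i)"
  shows "f (put_block ns i x z) - f x = F i z - F i (block ns i x)"
proof -
  let ?A = "\<Sum>j\<in>{1..m} - {i}. F j (block ns j x)"
  have xn: "x \<in> Rn n" using x by (simp add: edom_def)
  have "put_block ns i x z \<in> Rn n"
    using put_block_in_Rn[OF i, of x ns] xn dim by simp
  then have "f (put_block ns i x z) = F i z + ?A"
    using i z by (simp add: f_eq sum.remove[of _ i] block_put_block_same block_put_block_other)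
  moreover have "f x = F i (block ns i x) + ?A"
    using i xn by (simp add: f_eq sum.remove[of _ i])
  moreover have "\<bar>?A\<bar> \<noteq> \<infinity>"
    using F_finite[OF x] by (auto simp: sum_Inf)
  moreover have "\<bar>F i (block ns i x)\<bar> \<noteq> \<infinity>" "F i z \<noteq> -\<infinity>"
    using F_finite[OF x i] F_not_MInf[OF i z] by auto
  ultimately show ?thesis
    by (cases rule: ereal3_cases[of "F i z" ?A "F i (block ns i x)"]) auto
qed

text \<open>
  Injectivity of \<^const>\<open>put_block\<close> keeps the approach punctured. For \<open>ns i = 0\<close> there is nothing
  to approach along: the source filter is \<^term>\<open>bot\<close>.
\<close>

lemma filterlim_put_block_atin:
  assumes x: "x \<in> Rn n" and i: "i \<in> {1..m}"
  shows "filterlim (put_block ns i x) (atin (Euclidean_space n) x)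
           (atin (Euclidean_space (ns i)) (block ns i x))"
proof -
  let ?X = "Euclidean_space (ns i)"
  have "filterlim (put_block ns i x) (nhdsin (Euclidean_space n) x) (atin ?X (block ns i x))"
    using filterlim_nhdsin_continuous_map[OF continuous_map_put_block[OF i, of x ns], of "block ns i x"]
      x dim by (auto simp: put_block_block atin_def intro: filterlim_mono)
  moreover have "\<forall>\<^sub>F z in atin ?X (block ns i x). put_block ns i x z \<in> Rn n - {x}"
  proof -
    have "put_block ns i x z \<in> Rn n - {x}" if "z \<in> Rn (ns i) - {block ns i x}" for z
      using that put_block_in_Rn[OF i, of x ns] block_put_block_same[of z ns i x] x dim by auto
    then show ?thesis
      by (auto simp: atin_def eventually_inf_principal)
  qed
  ultimately show ?thesis
    by (auto simp: atin_def filterlim_inf filterlim_principal)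
qed

text \<open>
  Along points that differ from \<open>x\<close> in the \<open>i\<close>-th block only, the difference quotients of \<open>f\<close> and
  of \<open>F i\<close> coincide.
\<close>

lemma regular_subdiff_block:
  assumes v: "v \<in> regular_subdiff n f x" and i: "i \<in> {1..m}"
  shows "block ns i v \<in> regular_subdiff (ns i) (F i) (block ns i x)"
proof -
  let ?G = "atin (Euclidean_space (ns i)) (block ns i x)"
  let ?q = "\<lambda>z. (f z - f x - ereal (Rn_inner n v (Rn_diff z x))) / ereal (Rn_norm n (Rn_diff z x))"
  let ?qi = "\<lambda>z. (F i z - F i (block ns i x)
                 - ereal (Rn_inner (ns i) (block ns i v) (Rn_diff z (block ns i x))))
               / ereal (Rn_norm (ns i) (Rn_diff z (block ns i x)))"
  have x: "x \<in> edom n f" and L: "0 \<le> Liminf (atin (Euclidean_space n) x) ?q"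
    using v by (auto simp: regular_subdiff_def split: if_splits)
  have xn: "x \<in> Rn n" using x by (simp add: edom_def)
  have "0 \<le> Liminf ?G (\<lambda>z. ?q (put_block ns i x z))"
    using filterlim_put_block_atin[OF xn i] L by (rule le_Liminf_compose)
  also have "\<dots> = Liminf ?G ?qi"
  proof (rule Liminf_eq)
    have "?q (put_block ns i x z) = ?qi z" if "z \<in> Rn (ns i)" for z
      using f_put_block_diff[OF x i that] Rn_inner_put_block[OF i, of ns v x z]
        Rn_norm_put_block[OF i, of ns x z] dim by simp
    then show "\<forall>\<^sub>F z in ?G. ?q (put_block ns i x z) = ?qi z"
      by (auto simp: atin_def eventually_inf_principal)
  qed
  finally show ?thesis
    using F_finite[OF x i] by (auto simp: regular_subdiff_def edom_def)
qed

text \<open>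
  The blocks of the approximating points and regular subgradients approximate in turn; convergence
  of the values of \<open>F i\<close> is the point at which closedness of all the summands enters.
\<close>

lemma limiting_subdiff_block:
  assumes v: "v \<in> limiting_subdiff n f x" and i: "i \<in> {1..m}"
  shows "block ns i v \<in> limiting_subdiff (ns i) (F i) (block ns i x)"
proof -
  have x: "x \<in> edom n f"
    using v by (auto simp: limiting_subdiff_def split: if_splits)
  then have xn: "x \<in> Rn n" by (simp add: edom_def)
  obtain xs vs where xs: "limitin (Euclidean_space n) xs x sequentially"
    and fxs: "(\<lambda>t. f (xs t)) \<longlonglongrightarrow> f x"
    and vs: "limitin (Euclidean_space n) vs v sequentially"
    and reg: "\<And>t. vs t \<in> regular_subdiff n f (xs t)"
    using v x by (auto simp: limiting_subdiff_def)
  have dom: "xs t \<in> edom n f" for t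
    using reg[of t] by (auto simp: regular_subdiff_def split: if_splits)
  then have xsn: "xs t \<in> Rn n" for t by (simp add: edom_def)
  have "(\<lambda>t. F i (block ns i (xs t))) \<longlonglongrightarrow> F i (block ns i x)"
  proof (rule tendsto_summand[where I = "{1..m}" and l = "\<lambda>i. F i (block ns i x)"
        and X = "\<lambda>i t. F i (block ns i (xs t))"])
    show "F j (block ns j x) \<le> Liminf sequentially (\<lambda>t. F j (block ns j (xs t)))"
      if j: "j \<in> {1..m}" for j
      using j filterlim_nhdsin_of_limitin[OF limitin_block[OF xs]]
      by (intro F_le_Liminf_compose) auto
    show "(\<lambda>t. \<Sum>j=1..m. F j (block ns j (xs t))) \<longlonglongrightarrow> (\<Sum>j=1..m. F j (block ns j x))"
      using fxs by (simp add: f_eq xn xsn)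
  qed (use i F_finite[OF x] F_finite[OF dom] in auto)
  then have "\<exists>ys us. limitin (Euclidean_space (ns i)) ys (block ns i x) sequentially
      \<and> (\<lambda>t. F i (ys t)) \<longlonglongrightarrow> F i (block ns i x)
      \<and> limitin (Euclidean_space (ns i)) us (block ns i v) sequentially
      \<and> (\<forall>t. us t \<in> regular_subdiff (ns i) (F i) (ys t))"
    by (intro exI[of _ "\<lambda>t. block ns i (xs t)"] exI[of _ "\<lambda>t. block ns i (vs t)"] conjI allI
        limitin_block[OF xs] limitin_block[OF vs] regular_subdiff_block[OF reg i])
  moreover have "block ns i x \<in> edom (ns i) (F i)"
    using F_finite[OF x i] by (auto simp: edom_def)
  ultimately show ?thesis
    by (simp only: limiting_subdiff_def if_True mem_Collect_eq)
qed

lemma dom_subdiff_block: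
  assumes "x \<in> dom_subdiff n f" "i \<in> {1..m}"
  shows "block ns i x \<in> dom_subdiff (ns i) (F i)"
proof -
  obtain v where "v \<in> limiting_subdiff n f x"
    using assms(1) by (auto simp: dom_subdiff_def)
  from limiting_subdiff_block[OF this assms(2)] show ?thesis
    by (auto simp: dom_subdiff_def)
qed

end

section \<open>The Kurdyka-Lojasiewicz inequality\<close>

lemma eventually_less_of_continuous_on_dom_subdiff:
  assumes cont: "continuous_map (subtopology (Euclidean_space k) (dom_subdiff k g)) euclidean g"
    and xb: "xb \<in> dom_subdiff k g" and u: "g xb < u"
  shows "\<forall>\<^sub>F z in nhdsin (Euclidean_space k) xb. z \<in> dom_subdiff k g \<longrightarrow> g z < u"
proof -
  have "filterlim g (nhdsin euclidean (g xb)) (nhdsin (subtopology (Euclidean_space k) (dom_subdiff k g)) xb)"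
    using cont xb by (intro filterlim_nhdsin_continuous_map) (auto simp: dom_subdiff_def)
  moreover have "\<forall>\<^sub>F y in nhdsin euclidean (g xb). y < u"
    unfolding eventually_nhdsin using u by (intro disjI2 exI[of _ "{..<u}"]) auto
  ultimately have "\<forall>\<^sub>F z in nhdsin (subtopology (Euclidean_space k) (dom_subdiff k g)) xb. g z < u"
    by (auto simp: filterlim_iff)
  moreover have "xb \<in> topspace (subtopology (Euclidean_space k) (dom_subdiff k g))"
    using xb by (simp add: dom_subdiff_def)
  ultimately obtain S where "openin (subtopology (Euclidean_space k) (dom_subdiff k g)) S"
      "xb \<in> S" "\<forall>z\<in>S. g z < u"
    unfolding eventually_nhdsin by blast
  then obtain T where "openin (Euclidean_space k) T" "S = T \<inter> dom_subdiff k g"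
    unfolding openin_subtopology by blast
  with \<open>xb \<in> S\<close> \<open>\<forall>z\<in>S. g z < u\<close> show ?thesis
    unfolding eventually_nhdsin by (intro disjI2 exI[of _ T]) auto
qed

text \<open>
  This is the KL inequality in the form that suits a sum: continuity on the domain of the
  subdifferential replaces the upper bound on \<^term>\<open>g z\<close>, and it keeps
  \<^term>\<open>g z - g xb\<close> below \<open>1\<close>, where a larger exponent gives a smaller power.
\<close>

lemma KL_property_at_nhdsin:
  assumes KL: "KL_property_at k g xb a" and le: "a \<le> \<alpha>"
    and cont: "continuous_map (subtopology (Euclidean_space k) (dom_subdiff k g)) euclidean g"
  obtains c where "0 < c"
    "\<forall>\<^sub>F z in nhdsin (Euclidean_space k) xb. \<forall>v\<in>limiting_subdiff k g z. g xb < g z \<longrightarrow>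
       c * real_of_ereal (g z - g xb) powr \<alpha> \<le> Rn_norm k v"
proof -
  obtain c e \<nu> where c: "0 < c" "0 < e" "0 < (\<nu>::ereal)"
    and ineq: "\<And>x. \<lbrakk>x \<in> Rn k; Rn_norm k (Rn_diff x xb) \<le> e; g xb < g x; g x < g xb + \<nu>\<rbrakk> \<Longrightarrow>
           ereal (c * real_of_ereal (g x - g xb) powr a) \<le> dist_zero k (limiting_subdiff k g x)"
    using KL unfolding KL_property_at_def by blast
  have xb: "xb \<in> dom_subdiff k g" and proper: "proper_fun k g"
    using KL by (simp_all add: KL_property_at_def)
  have xk: "xb \<in> Rn k" using xb by (simp add: dom_subdiff_def)
  have fin: "\<bar>g xb\<bar> \<noteq> \<infinity>"
    using xb proper by (auto simp: dom_subdiff_def limiting_subdiff_def edom_def proper_fun_def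
        split: if_splits)
  have "g xb < g xb + min \<nu> 1"
    using fin c(3) by (cases "g xb"; cases \<nu>) (auto simp: min_def)
  from eventually_less_of_continuous_on_dom_subdiff[OF cont xb this]
    eventually_Rn_norm_le[OF xk c(2)]
  have "\<forall>\<^sub>F z in nhdsin (Euclidean_space k) xb. \<forall>v\<in>limiting_subdiff k g z. g xb < g z \<longrightarrow>
       c * real_of_ereal (g z - g xb) powr \<alpha> \<le> Rn_norm k v"
  proof eventually_elim
    case (elim z)
    show ?case
    proof (intro ballI impI)
      fix v assume v: "v \<in> limiting_subdiff k g z" and less: "g xb < g z"
      have gz: "g z < g xb + min \<nu> 1"
        using elim v by (auto simp: dom_subdiff_def)
      then have "g z < g xb + \<nu>" "g z < g xb + 1"
        using add_left_mono[OF min.cobounded1, of "g xb" \<nu> 1]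
          add_left_mono[OF min.cobounded2, of "g xb" \<nu> 1] by (simp_all only: less_le_trans)
      then have "ereal (c * real_of_ereal (g z - g xb) powr a) \<le> dist_zero k (limiting_subdiff k g z)"
        using elim less by (intro ineq) auto
      also have "\<dots> \<le> ereal (Rn_norm k v)"
        unfolding dist_zero_def using v by (rule INF_lower)
      finally have "c * real_of_ereal (g z - g xb) powr a \<le> Rn_norm k v" by simp
      moreover have "0 < real_of_ereal (g z - g xb)" "real_of_ereal (g z - g xb) \<le> 1"
        using fin less \<open>g z < g xb + 1\<close> by (cases "g xb"; cases "g z"; auto)+
      then have "real_of_ereal (g z - g xb) powr \<alpha> \<le> real_of_ereal (g z - g xb) powr a"
        using le by (intro powr_mono') auto
      ultimately show "c * real_of_ereal (g z - g xb) powr \<alpha> \<le> Rn_norm k v"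
        using c(1) by (meson mult_left_mono less_imp_le order_trans)
    qed
  qed
  with c(1) show thesis by (rule that)
qed

context separable_sum
begin

text \<open>
  Pigeonhole: if every block fell short of the average increment, the total would as well.
\<close>

lemma ex_large_block_increment:
  assumes x: "x \<in> edom n f" and y: "y \<in> edom n f" and less: "f y < f x"
  shows "\<exists>i\<in>{1..m}. F i (block ns i y) < F i (block ns i x) \<and>
           real_of_ereal (f x - f y)
             \<le> real m * real_of_ereal (F i (block ns i x) - F i (block ns i y))"
proof (rule ccontr)
  let ?d = "\<lambda>i. real_of_ereal (F i (block ns i x) - F i (block ns i y))"
  let ?D = "real_of_ereal (f x - f y)"
  assume neg: "\<not> ?thesis"
  define X where "X i = real_of_ereal (F i (block ns i x))" for i
  define Y where "Y i = real_of_ereal (F i (block ns i y))" for i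
  have FX: "F i (block ns i x) = ereal (X i)" and FY: "F i (block ns i y) = ereal (Y i)"
    if "i \<in> {1..m}" for i
    using F_finite[OF x that] F_finite[OF y that] by (simp_all add: X_def Y_def ereal_real')
  have fx: "f x = ereal (\<Sum>i=1..m. X i)" and fy: "f y = ereal (\<Sum>i=1..m. Y i)"
    using x y by (simp_all add: edom_def f_eq FX FY)
  have D: "?D = (\<Sum>i=1..m. X i - Y i)" "0 < ?D"
    using less by (simp_all add: fx fy sum_subtractf)
  then have "m \<noteq> 0" by (cases m) auto
  have "X i - Y i < ?D / m" if i: "i \<in> {1..m}" for i
  proof (cases "Y i < X i")
    case True
    with neg i have "\<not> ?D \<le> real m * ?d i" using FX[OF i] FY[OF i] by (metis less_ereal.simps(1))
    then have "\<not> ?D \<le> real m * (X i - Y i)" using FX[OF i] FY[OF i] by simp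
    then show ?thesis using \<open>m \<noteq> 0\<close> by (simp add: field_simps)
  next
    case False
    moreover have "0 < ?D / m" using D \<open>m \<noteq> 0\<close> by simp
    ultimately show ?thesis by linarith
  qed
  then have "(\<Sum>i=1..m. X i - Y i) < (\<Sum>i=1..m. ?D / m)"
    using \<open>m \<noteq> 0\<close> by (intro sum_strict_mono) auto
  then show False using D \<open>m \<noteq> 0\<close> by simp
qed

lemma KL_property_at_sum:
  assumes xb: "xb \<in> dom_subdiff n f" and \<alpha>: "0 \<le> \<alpha>" "\<alpha> < 1"
    and KL: "\<And>i. i \<in> {1..m} \<Longrightarrow> \<exists>a\<le>\<alpha>. KL_property_at (ns i) (F i) (block ns i xb) a"
    and cont: "\<And>i. i \<in> {1..m} \<Longrightarrow>
           continuous_map (subtopology (Euclidean_space (ns i)) (dom_subdiff (ns i) (F i)))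
             euclidean (F i)"
  shows "KL_property_at n f xb \<alpha>"
proof -
  let ?good = "\<lambda>c i z. \<forall>v\<in>limiting_subdiff (ns i) (F i) z. F i (block ns i xb) < F i z \<longrightarrow>
       c * real_of_ereal (F i z - F i (block ns i xb)) powr \<alpha> \<le> Rn_norm (ns i) v"
  have xn: "xb \<in> Rn n" using xb by (simp add: dom_subdiff_def)
  have xdom: "xb \<in> edom n f"
    using xb by (auto simp: dom_subdiff_def limiting_subdiff_def split: if_splits)
  have "\<forall>i\<in>{1..m}. \<exists>c>0. eventually (?good c i) (nhdsin (Euclidean_space (ns i)) (block ns i xb))"
  proof
    fix i assume i: "i \<in> {1..m}"
    obtain a where "a \<le> \<alpha>" "KL_property_at (ns i) (F i) (block ns i xb) a"
      using KL[OF i] by blast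
    from KL_property_at_nhdsin[OF this(2,1) cont[OF i]]
    show "\<exists>c>0. eventually (?good c i) (nhdsin (Euclidean_space (ns i)) (block ns i xb))"
      by blast
  qed
  from bchoice[OF this] obtain c
    where "\<forall>i\<in>{1..m}. 0 < c i \<and>
         eventually (?good (c i) i) (nhdsin (Euclidean_space (ns i)) (block ns i xb))"
    by (elim exE)
  then have c: "\<And>i. i \<in> {1..m} \<Longrightarrow> 0 < c i"
    and ev: "\<And>i. i \<in> {1..m} \<Longrightarrow>
         eventually (?good (c i) i) (nhdsin (Euclidean_space (ns i)) (block ns i xb))"
    by (simp_all only: Ball_def)
  have "\<forall>\<^sub>F z in nhdsin (Euclidean_space n) xb. ?good (c i) i (block ns i z)"
    if i: "i \<in> {1..m}" for i
    using filterlim_block[OF xn, of ns i] ev[OF i] unfolding filterlim_iff by (elim allE impE)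
  then have "\<forall>\<^sub>F z in nhdsin (Euclidean_space n) xb. \<forall>i\<in>{1..m}. ?good (c i) i (block ns i z)"
    by (intro eventually_ball_finite ballI) simp_all
  then obtain e where e: "0 < e"
    and good: "\<And>z. \<lbrakk>z \<in> Rn n; Rn_norm n (Rn_diff z xb) \<le> e\<rbrakk> \<Longrightarrow> \<forall>i\<in>{1..m}. ?good (c i) i (block ns i z)"
    using Rn_norm_ball_nhdsin[OF xn] by blast
  \<comment> \<open>The extra element \<open>1\<close> keeps the minimum over a nonempty set when \<open>m = 0\<close>; for the same
    reason the constant below has \<open>m + 1\<close> in place of \<open>m\<close>.\<close>
  define C where "C = Min (insert 1 (c ` {1..m}))"
  have C: "0 < C"
    using c by (auto simp: C_def)
  have C_le: "C \<le> c i" if "i \<in> {1..m}" for i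
    unfolding C_def using that by (intro Min_le) auto
  have "ereal (C / (real m + 1) powr \<alpha> * real_of_ereal (f x - f xb) powr \<alpha>)
          \<le> dist_zero n (limiting_subdiff n f x)"
    if x: "x \<in> Rn n" "Rn_norm n (Rn_diff x xb) \<le> e" and less: "f xb < f x" for x
    unfolding dist_zero_def
  proof (rule INF_greatest)
    fix v assume v: "v \<in> limiting_subdiff n f x"
    then have "x \<in> edom n f" by (auto simp: limiting_subdiff_def split: if_splits)
    from ex_large_block_increment[OF this xdom less]
    obtain i where i: "i \<in> {1..m}" and Fi: "F i (block ns i xb) < F i (block ns i x)"
      and large: "real_of_ereal (f x - f xb)
            \<le> real m * real_of_ereal (F i (block ns i x) - F i (block ns i xb))"
      by blast
    let ?D = "real_of_ereal (f x - f xb)"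
    let ?d = "real_of_ereal (F i (block ns i x) - F i (block ns i xb))"
    have d: "0 \<le> ?d" using Fi
      by (cases "F i (block ns i x)"; cases "F i (block ns i xb)") auto
    have D: "0 \<le> ?D" using less by (cases "f x"; cases "f xb") auto
    have "?D \<le> (real m + 1) * ?d" using large d by (simp add: algebra_simps)
    then have "?D / (real m + 1) \<le> ?d" by (simp add: field_simps)
    then have "(?D / (real m + 1)) powr \<alpha> \<le> ?d powr \<alpha>"
      using \<alpha> D by (intro powr_mono2) auto
    then have "C * (?D / (real m + 1)) powr \<alpha> \<le> c i * ?d powr \<alpha>"
      using C C_le[OF i] by (intro mult_mono) (auto intro: less_imp_le)
    also have "\<dots> \<le> Rn_norm (ns i) (block ns i v)"
      using good[OF x] i limiting_subdiff_block[OF v i] Fi by blast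
    also have "\<dots> \<le> Rn_norm n v"
      using Rn_norm_block_le[OF i, of ns v] dim by simp
    finally show "ereal (C / (real m + 1) powr \<alpha> * ?D powr \<alpha>) \<le> ereal (Rn_norm n v)"
      using D by (simp add: powr_divide)
  qed
  moreover have "0 < C / (real m + 1) powr \<alpha>" using C by simp
  ultimately have "\<exists>c e \<nu>. 0 < (c::real) \<and> 0 < (e::real) \<and> 0 < (\<nu>::ereal) \<and>
        (\<forall>x\<in>Rn n. Rn_norm n (Rn_diff x xb) \<le> e \<and> f xb < f x \<and> f x < f xb + \<nu> \<longrightarrow>
           ereal (c * real_of_ereal (f x - f xb) powr \<alpha>)
             \<le> dist_zero n (limiting_subdiff n f x))"
    using e by (intro exI[of _ "C / (real m + 1) powr \<alpha>"] exI[of _ e] exI[of _ \<infinity>]) auto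
  then show ?thesis
    using proper_f closed_f xb \<alpha> unfolding KL_property_at_def by blast
qed

end

theorem theorem3p3:
  fixes m n :: nat
    and ns :: "nat \<Rightarrow> nat"
    and F :: "nat \<Rightarrow> (nat \<Rightarrow> real) \<Rightarrow> ereal"
    and f :: "(nat \<Rightarrow> real) \<Rightarrow> ereal"
    and \<alpha> :: "nat \<Rightarrow> real"
  assumes "1 \<le> m"
    and "(\<Sum>i=1..m. ns i) = n"
    and "\<And>x. x \<in> Rn n \<Longrightarrow> f x = (\<Sum>i=1..m. F i (block ns i x))"
    and "\<And>i. i \<in> {1..m} \<Longrightarrow> proper_fun (ns i) (F i)"
    and "\<And>i. i \<in> {1..m} \<Longrightarrow> closed_fun (ns i) (F i)"
    and "\<And>i. i \<in> {1..m} \<Longrightarrow> 0 < \<alpha> i \<and> \<alpha> i < 1"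
    and "\<And>i. i \<in> {1..m} \<Longrightarrow> KL_function (ns i) (F i) (\<alpha> i)"
    and "\<And>i. i \<in> {1..m} \<Longrightarrow>
           continuous_map (subtopology (Euclidean_space (ns i)) (dom_subdiff (ns i) (F i)))
             euclidean (F i)"
  shows "KL_function n f (Max (\<alpha> ` {1..m}))"
proof -
  interpret separable_sum m n ns F f
    using assms(2-5) by unfold_locales
  let ?\<alpha> = "Max (\<alpha> ` {1..m})"
  have "?\<alpha> \<in> \<alpha> ` {1..m}"
    using assms(1) by (intro Max_in) auto
  then have \<alpha>: "0 \<le> ?\<alpha>" "?\<alpha> < 1"
    using assms(6) by (force intro: less_imp_le)+
  have "KL_property_at n f xb ?\<alpha>" if xb: "xb \<in> dom_subdiff n f" for xb
  proof (rule KL_property_at_sum[OF xb \<alpha>])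
    fix i assume i: "i \<in> {1..m}"
    have "KL_property_at (ns i) (F i) (block ns i xb) (\<alpha> i)"
      using assms(7)[OF i] dom_subdiff_block[OF xb i] by (simp add: KL_function_def)
    then show "\<exists>a\<le>?\<alpha>. KL_property_at (ns i) (F i) (block ns i xb) a"
      using i by (intro exI[of _ "\<alpha> i"]) auto
  qed (use assms(8) in auto)
  then show ?thesis
    using proper_f closed_f \<alpha> by (simp add: KL_function_def)
qed

end
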